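(* Let $n\ge 5$ and let $S_n^3 = K_n\vee\overline{K_3}$ be the complete split graph. Then the all-negative signature maximises the frustration index of $S_n^3$ uniquely, and \[ l_{\max}(S_n^3) = l(-S_n^3) = \left\lfloor \frac{(n-1)^2}{4} + \frac{3n}{2} - \frac{9}{4}\right\rfloor . \]
   Context: All graphs are finite, simple and undirected. A signed graph $\Sigma=(G,\sigma)$ is a graph $G$ with a signature $\sigma:E(G)\to\{+1,-1\}$. The sign of a cycle is the product of the signs of its edges; $\Sigma$ is balanced if all its cycles are positive. The frustration index $l(\Sigma)$ is the minimum number of edges whose deletion makes $\Sigma$ balanced. $-G$ is $G$ with all edges signed $-1$. $l_{\max}(G)=\max_\sigma l(G,\sigma)$. Switching $\Sigma$ at a vertex subset $X$ negates the signs of all edges with exactly one endpoint in $X$; two signatures are switching equivalent if one is obtained from the other by switching. The all-negative signature maximises the frustration index of $G$ uniquely if $l(-G)=l_{\max}(G)$ and every $\sigma$ with $l(G,\sigma)=l_{\max}(G)$ is switching equivalent to the all-negative signature. $\overline{K_m}$ is the edgeless graph on $m$ vertices and $\vee$ denotes the join. *)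

theory Defs
  imports Complex_Main "HOL-Library.FuncSet"
begin

section \<open>Simple graphs\<close>

record 'a ugraph =
  verts :: "'a set"
  edges :: "'a set set"

definition simple_graph :: "'a ugraph \<Rightarrow> bool" where
  "simple_graph G \<longleftrightarrow>
     finite (verts G) \<and> (\<forall>e\<in>edges G. e \<subseteq> verts G \<and> card e = 2)"

definition complete_graph :: "'a set \<Rightarrow> 'a ugraph" where
  "complete_graph A = \<lparr>verts = A, edges = {e. e \<subseteq> A \<and> card e = 2}\<rparr>"

definition edgeless_graph :: "'a set \<Rightarrow> 'a ugraph" where
  "edgeless_graph A = \<lparr>verts = A, edges = {}\<rparr>"

text \<open>The sum type makes the two vertex sets disjoint, as the join requires.\<close>

definition join :: "'a ugraph \<Rightarrow> 'b ugraph \<Rightarrow> ('a + 'b) ugraph" where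
  "join G H =
     \<lparr>verts = Inl ` verts G \<union> Inr ` verts H,
      edges = (\<lambda>e. Inl ` e) ` edges G \<union> (\<lambda>e. Inr ` e) ` edges H
        \<union> {{Inl u, Inr v} | u v. u \<in> verts G \<and> v \<in> verts H}\<rparr>"

definition complete_split :: "nat \<Rightarrow> nat \<Rightarrow> (nat + nat) ugraph" where
  "complete_split n m = join (complete_graph {..<n}) (edgeless_graph {..<m})"

lemma simple_graph_complete_graph:
  "finite A \<Longrightarrow> simple_graph (complete_graph A)"
  by (simp add: simple_graph_def complete_graph_def)

lemma simple_graph_edgeless_graph:
  "finite A \<Longrightarrow> simple_graph (edgeless_graph A)"
  by (simp add: simple_graph_def edgeless_graph_def)

lemma simple_graph_join:
  assumes "simple_graph G" "simple_graph H"
  shows "simple_graph (join G H)"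
  unfolding simple_graph_def
proof (intro conjI ballI)
  show "finite (verts (join G H))"
    using assms by (simp add: simple_graph_def join_def)
  fix e assume "e \<in> edges (join G H)"
  then consider a where "a \<in> edges G" "e = Inl ` a"
    | a where "a \<in> edges H" "e = Inr ` a"
    | u v where "u \<in> verts G" "v \<in> verts H" "e = {Inl u, Inr v}"
    by (auto simp: join_def)
  then show "e \<subseteq> verts (join G H)" "card e = 2"
    using assms by (cases; force simp: simple_graph_def join_def card_image)+
qed

lemma simple_graph_complete_split: "simple_graph (complete_split n m)"
  by (simp add: complete_split_def simple_graph_join
      simple_graph_complete_graph simple_graph_edgeless_graph)

text \<open>
  A cycle is given by the list of its vertices in cyclic order, so each cycle of
  length \<open>k\<close> is represented by \<open>2 * k\<close> lists.
\<close>

definition cycle_edge :: "'a list \<Rightarrow> nat \<Rightarrow> 'a set" where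
  "cycle_edge c i = {c ! i, c ! (Suc i mod length c)}"

definition is_cycle :: "'a ugraph \<Rightarrow> 'a list \<Rightarrow> bool" where
  "is_cycle G c \<longleftrightarrow>
     length c \<ge> 3 \<and> distinct c \<and> set c \<subseteq> verts G \<and>
     (\<forall>i<length c. cycle_edge c i \<in> edges G)"

definition delete_edges :: "'a ugraph \<Rightarrow> 'a set set \<Rightarrow> 'a ugraph" where
  "delete_edges G D = \<lparr>verts = verts G, edges = edges G - D\<rparr>"


section \<open>Signed graphs\<close>

text \<open>
  Signatures are extensional functions on the edge set: two signatures are equal
  iff they agree on all edges, and a finite graph has finitely many of them.
\<close>

definition signatures :: "'a ugraph \<Rightarrow> ('a set \<Rightarrow> int) set" where
  "signatures G = edges G \<rightarrow>\<^sub>E {1, -1}"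

definition all_negative :: "'a ugraph \<Rightarrow> 'a set \<Rightarrow> int" where
  "all_negative G = (\<lambda>e\<in>edges G. -1)"

definition cycle_sign :: "('a set \<Rightarrow> int) \<Rightarrow> 'a list \<Rightarrow> int" where
  "cycle_sign \<sigma> c = (\<Prod>i<length c. \<sigma> (cycle_edge c i))"

definition balanced :: "'a ugraph \<Rightarrow> ('a set \<Rightarrow> int) \<Rightarrow> bool" where
  "balanced G \<sigma> \<longleftrightarrow> (\<forall>c. is_cycle G c \<longrightarrow> cycle_sign \<sigma> c = 1)"

definition frustration_index :: "'a ugraph \<Rightarrow> ('a set \<Rightarrow> int) \<Rightarrow> nat" where
  "frustration_index G \<sigma> =
     Min {card D | D. D \<subseteq> edges G \<and>
       balanced (delete_edges G D) (restrict \<sigma> (edges G - D))}"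

definition max_frustration :: "'a ugraph \<Rightarrow> nat" where
  "max_frustration G = Max (frustration_index G ` signatures G)"

text \<open>An edge has exactly one endpoint in \<open>X\<close> iff it meets \<open>X\<close> in exactly one vertex.\<close>

definition switch :: "'a ugraph \<Rightarrow> 'a set \<Rightarrow> ('a set \<Rightarrow> int) \<Rightarrow> 'a set \<Rightarrow> int" where
  "switch G X \<sigma> = (\<lambda>e\<in>edges G. if card (e \<inter> X) = 1 then - \<sigma> e else \<sigma> e)"

definition switching_equivalent ::
  "'a ugraph \<Rightarrow> ('a set \<Rightarrow> int) \<Rightarrow> ('a set \<Rightarrow> int) \<Rightarrow> bool" where
  "switching_equivalent G \<sigma> \<tau> \<longleftrightarrow> (\<exists>X\<subseteq>verts G. \<tau> = switch G X \<sigma>)"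

definition all_negative_uniquely_maximal :: "'a ugraph \<Rightarrow> bool" where
  "all_negative_uniquely_maximal G \<longleftrightarrow>
     frustration_index G (all_negative G) = max_frustration G \<and>
     (\<forall>\<sigma>\<in>signatures G. frustration_index G \<sigma> = max_frustration G \<longrightarrow>
        switching_equivalent G \<sigma> (all_negative G))"

lemma all_negative_in_signatures: "all_negative G \<in> signatures G"
  by (auto simp: all_negative_def signatures_def)

lemma finite_edges:
  assumes "simple_graph G"
  shows "finite (edges G)"
proof (rule finite_subset)
  show "edges G \<subseteq> Pow (verts G)"
    using assms by (auto simp: simple_graph_def)
  show "finite (Pow (verts G))"
    using assms by (simp add: simple_graph_def)
qed

text \<open>The \<open>Min\<close> and \<open>Max\<close> above are taken over finite nonempty sets.\<close>

lemma frustration_index_well_defined: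
  fixes G :: "'a ugraph" and \<sigma> :: "'a set \<Rightarrow> int"
  assumes "simple_graph G"
  defines "S \<equiv> {card D | D. D \<subseteq> edges G \<and>
    balanced (delete_edges G D) (restrict \<sigma> (edges G - D))}"
  shows "finite S" "S \<noteq> {}"
proof -
  have "S \<subseteq> card ` Pow (edges G)"
    by (auto simp: S_def)
  then show "finite S"
    using finite_edges[OF assms(1)] by (meson finite_Pow_iff finite_imageI finite_subset)
  have "\<not> is_cycle (delete_edges G (edges G)) c" for c
    by (auto simp: is_cycle_def delete_edges_def intro!: exI[of _ 0])
  then have "balanced (delete_edges G (edges G)) (restrict \<sigma> (edges G - edges G))"
    by (simp add: balanced_def)
  then show "S \<noteq> {}"
    unfolding S_def by blast
qed

lemma max_frustration_well_defined:
  assumes "simple_graph G"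
  shows "finite (frustration_index G ` signatures G)"
    "frustration_index G ` signatures G \<noteq> {}"
  using finite_edges[OF assms] all_negative_in_signatures[of G]
  by (auto simp: signatures_def intro!: finite_imageI finite_PiE)

end

theory Submission
  imports Defs
begin

text \<open>
  After switching by signs \<open>s\<close>, the number of negative edges is half of
  \<open>|E| - (\<Sum>e\<in>E. \<sigma> e * prod s e)\<close>, so upper bounds on the frustration index are lower bounds on
  the maximum of this sum. Adding a vertex of the clique never decreases the maximum, and increases it
  if the new vertex has odd degree, that is, for every second vertex. It
  therefore suffices to start from 6 on three clique vertices when all triangles through
  independent vertices are negative, and from 9 on five clique vertices otherwise; the second value
  is larger than the one of the all-negative signature, whence uniqueness. Conversely, deleting
  edges until the all-negative signature is balanced leaves a triangle-free graph, and Mantel's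
  bound on \<open>n + 3\<close> vertices is exactly what is needed.
\<close>

section \<open>Five clique vertices\<close>

lemma sum_lessThan_5:
  "(\<Sum>i<5. h i) = h 0 + h 1 + h 2 + h 3 + h 4" for h :: "nat \<Rightarrow> int"
  by (simp add: eval_nat_numeral)

lemma sum_pairs_lessThan_5:
  "(\<Sum>j<5. \<Sum>i<j. h i j) = h 0 1 + h 0 2 + h 0 3 + h 0 4 + h 1 2 + h 1 3 + h 1 4
     + h 2 3 + h 2 4 + h 3 4" for h :: "nat \<Rightarrow> nat \<Rightarrow> int"
  by (simp add: eval_nat_numeral)

text \<open>
  The type \<open>f i\<close> of a clique vertex \<open>i\<close> is its triple of signs towards the three independent
  vertices, up to negation; so there are four types. Switching normalises these triples to have
  product 1, and then distinct triples have inner product -1: this is the origin of the weights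
  3 and -1, where \<open>t\<close> is the triple of signs given to the independent vertices.
\<close>

locale five_vertices =
  fixes q :: "nat \<Rightarrow> nat \<Rightarrow> int" and f :: "nat \<Rightarrow> 't" and T :: "'t set"
  assumes sign: "\<And>i j. i < j \<Longrightarrow> j < 5 \<Longrightarrow> \<bar>q i j\<bar> = 1"
    and type_in: "\<And>i. i < 5 \<Longrightarrow> f i \<in> T"
    and card_T: "card T = 4"
    and bound: "\<And>x t. t \<in> T \<Longrightarrow> (\<And>i. i < 5 \<Longrightarrow> \<bar>x i\<bar> = 1) \<Longrightarrow>
      (\<Sum>j<5. \<Sum>i<j. q i j * (x i * x j)) + (\<Sum>i<5. (if f i = t then 3 else -1) * x i) \<le> 7"
begin

lemma signs:
  "\<bar>q 0 1\<bar> = 1" "\<bar>q 0 2\<bar> = 1" "\<bar>q 0 3\<bar> = 1" "\<bar>q 0 4\<bar> = 1" "\<bar>q 1 2\<bar> = 1"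
  "\<bar>q 1 3\<bar> = 1" "\<bar>q 1 4\<bar> = 1" "\<bar>q 2 3\<bar> = 1" "\<bar>q 2 4\<bar> = 1" "\<bar>q 3 4\<bar> = 1"
  by (simp_all add: sign)

lemma types: "f 0 \<in> T" "f 1 \<in> T" "f 2 \<in> T" "f 3 \<in> T" "f 4 \<in> T"
  by (simp_all add: type_in)

text \<open>Separate variables for the five signs: substituting concrete values turns each switching
  into a linear inequality in the ten numbers \<open>q i j\<close>, so that together with
  \<open>signs\<close> a finite set of switchings leaves a purely linear problem.\<close>

lemma bound_expanded:
  assumes "t \<in> T" "\<bar>x0\<bar> = 1" "\<bar>x1\<bar> = 1" "\<bar>x2\<bar> = 1" "\<bar>x3\<bar> = 1" "\<bar>x4\<bar> = 1"
  shows "q 0 1 * (x0 * x1) + q 0 2 * (x0 * x2) + q 0 3 * (x0 * x3) + q 0 4 * (x0 * x4)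
    + q 1 2 * (x1 * x2) + q 1 3 * (x1 * x3) + q 1 4 * (x1 * x4)
    + q 2 3 * (x2 * x3) + q 2 4 * (x2 * x4) + q 3 4 * (x3 * x4)
    + (if f 0 = t then 3 else -1) * x0 + (if f 1 = t then 3 else -1) * x1
    + (if f 2 = t then 3 else -1) * x2 + (if f 3 = t then 3 else -1) * x3
    + (if f 4 = t then 3 else -1) * x4 \<le> 7"
proof -
  define x where "x = (\<lambda>i. [x0, x1, x2, x3, x4] ! i)"
  have "\<bar>x i\<bar> = 1" if "i < 5" for i
    using that assms(2-) by (auto simp: x_def less_Suc_eq eval_nat_numeral)
  then have "(\<Sum>j<5. \<Sum>i<j. q i j * (x i * x j)) + (\<Sum>i<5. (if f i = t then 3 else -1) * x i) \<le> 7"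
    using bound[OF assms(1), of x] by blast
  note this[unfolded sum_pairs_lessThan_5, unfolded sum_lessThan_5]
  moreover have "x 0 = x0" "x 1 = x1" "x 2 = x2" "x 3 = x3" "x 4 = x4"
    by (simp_all add: x_def)
  ultimately show ?thesis
    by (simp only: add.assoc)
qed

text \<open>With all signs 1 the linear part is 15, so the ten clique signs sum to at most -8 and at
  most one of them is 1. If that one were \<open>q 0 1\<close>, negating only vertex 2 would give
  linear part 9 and pair part -4 + 4 = 0, which exceeds 7 in total.\<close>

lemma uniform:
  assumes "f 1 = f 0" "f 2 = f 0" "f 3 = f 0" "f 4 = f 0"
  shows "q 0 1 = -1"
proof -
  note bounds =
    types(1)[THEN bound_expanded, of 1 1 1 1 1]
    types(1)[THEN bound_expanded, of 1 1 "-1" 1 1]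
  show ?thesis
    using signs bounds[simplified, unfolded One_nat_def[symmetric]] assms by (smt (verit))
qed

text \<open>
  In each of the following cases a computer search found a smallest set of switchings that
  together rule out all \<open>2 ^ 10\<close> signatures of the clique.
\<close>

lemma four_one:
  assumes "f 1 = f 0" "f 2 = f 0" "f 3 = f 0" "f 4 \<noteq> f 0"
  shows False
proof -
  note bounds =
    types(1)[THEN bound_expanded, of 1 1 1 1 1]
    types(1)[THEN bound_expanded, of 1 1 1 1 "-1"]
    types(1)[THEN bound_expanded, of 1 1 1 "-1" 1]
    types(1)[THEN bound_expanded, of 1 1 1 "-1" "-1"]
    types(1)[THEN bound_expanded, of 1 1 "-1" 1 1]
    types(1)[THEN bound_expanded, of 1 1 "-1" 1 "-1"]
    types(5)[THEN bound_expanded, of 1 1 "-1" "-1" 1]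
    types(1)[THEN bound_expanded, of 1 "-1" 1 1 1]
    types(1)[THEN bound_expanded, of "-1" 1 1 1 1]
  show ?thesis
    using signs bounds[simplified, unfolded One_nat_def[symmetric]] assms by (smt (verit))
qed

lemma three_two:
  assumes "f 1 = f 0" "f 2 = f 0" "f 3 \<noteq> f 0" "f 4 = f 3"
  shows False
proof -
  note bounds =
    types(1)[THEN bound_expanded, of 1 1 1 1 1]
    types(1)[THEN bound_expanded, of 1 1 1 1 "-1"]
    types(1)[THEN bound_expanded, of 1 1 1 "-1" 1]
    types(4)[THEN bound_expanded, of "-1" "-1" 1 1 1]
    types(4)[THEN bound_expanded, of "-1" 1 "-1" 1 1]
    types(4)[THEN bound_expanded, of 1 "-1" "-1" 1 1]
  show ?thesis
    using signs bounds[simplified, unfolded One_nat_def[symmetric]] assms by (smt (verit))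
qed

lemma three_one_one:
  assumes "f 1 = f 0" "f 2 = f 0" "f 3 \<noteq> f 0" "f 4 \<noteq> f 0" "f 4 \<noteq> f 3"
  shows False
proof -
  \<comment> \<open>Only three of the four types occur. For the remaining type \<open>u\<close> all
    five weights are -1, which provides switchings that no occurring type gives.\<close>
  obtain u where u: "u \<in> T" "u \<notin> f ` {..<5}"
  proof -
    have "f ` {..<5} = {f 0, f 3, f 4}"
      using assms by (simp add: lessThan_Suc eval_nat_numeral insert_commute)
    then have "card (f ` {..<5}) < card T"
      using card_T by (simp add: card_insert_if)
    then show thesis
      using that card_mono[of "f ` {..<5}" T] by fastforce
  qed
  have absent: "f 0 \<noteq> u" "f 1 \<noteq> u" "f 2 \<noteq> u" "f 3 \<noteq> u" "f 4 \<noteq> u"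
    using u(2) by auto
  note bounds =
    types(1)[THEN bound_expanded, of 1 1 1 1 1]
    types(1)[THEN bound_expanded, of 1 1 1 1 "-1"]
    types(1)[THEN bound_expanded, of 1 1 1 "-1" "-1"]
    u(1)[THEN bound_expanded, of "-1" "-1" 1 "-1" "-1"]
    types(4)[THEN bound_expanded, of "-1" "-1" 1 1 "-1"]
    u(1)[THEN bound_expanded, of "-1" 1 "-1" "-1" "-1"]
    types(4)[THEN bound_expanded, of "-1" 1 "-1" 1 "-1"]
    types(4)[THEN bound_expanded, of 1 "-1" "-1" 1 "-1"]
    u(1)[THEN bound_expanded, of 1 "-1" "-1" "-1" "-1"]
  show ?thesis
    using signs bounds[simplified, unfolded One_nat_def[symmetric]] assms absent by (smt (verit))
qed

lemma two_two_one:
  assumes "f 1 = f 0" "f 2 \<noteq> f 0" "f 3 = f 2" "f 4 \<noteq> f 0" "f 4 \<noteq> f 2"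
  shows False
proof -
  note bounds =
    types(1)[THEN bound_expanded, of 1 1 1 1 1]
    types(5)[THEN bound_expanded, of "-1" "-1" "-1" "-1" 1]
    types(1)[THEN bound_expanded, of 1 1 1 "-1" 1]
    types(1)[THEN bound_expanded, of 1 1 1 "-1" "-1"]
    types(1)[THEN bound_expanded, of 1 1 "-1" 1 1]
    types(1)[THEN bound_expanded, of 1 1 "-1" 1 "-1"]
    types(3)[THEN bound_expanded, of "-1" "-1" 1 1 "-1"]
    types(3)[THEN bound_expanded, of 1 "-1" 1 1 1]
    types(5)[THEN bound_expanded, of 1 "-1" 1 "-1" 1]
    types(5)[THEN bound_expanded, of 1 "-1" "-1" 1 1]
    types(3)[THEN bound_expanded, of "-1" 1 1 1 1]
  show ?thesis
    using signs bounds[simplified, unfolded One_nat_def[symmetric]] assms by (smt (verit))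
qed

lemma two_one_one_one:
  assumes "f 1 = f 0" "f 2 \<noteq> f 0" "f 3 \<noteq> f 0" "f 4 \<noteq> f 0" "f 3 \<noteq> f 2" "f 4 \<noteq> f 2" "f 4 \<noteq> f 3"
  shows False
proof -
  note bounds =
    types(1)[THEN bound_expanded, of 1 1 1 1 1]
    types(5)[THEN bound_expanded, of "-1" "-1" "-1" "-1" 1]
    types(4)[THEN bound_expanded, of "-1" "-1" "-1" 1 "-1"]
    types(1)[THEN bound_expanded, of 1 1 1 "-1" "-1"]
    types(3)[THEN bound_expanded, of "-1" "-1" 1 "-1" "-1"]
    types(1)[THEN bound_expanded, of 1 1 "-1" "-1" "-1"]
    types(5)[THEN bound_expanded, of "-1" 1 "-1" "-1" 1]
    types(4)[THEN bound_expanded, of "-1" 1 "-1" 1 "-1"]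
    types(4)[THEN bound_expanded, of 1 "-1" "-1" 1 "-1"]
    types(5)[THEN bound_expanded, of 1 "-1" "-1" "-1" 1]
  show ?thesis
    using signs bounds[simplified, unfolded One_nat_def[symmetric]] assms by (smt (verit))
qed

end

section \<open>Switching and the frustration index\<close>

lemma even_sum_units:
  fixes f :: "'a \<Rightarrow> int"
  assumes "finite A" "\<And>a. a \<in> A \<Longrightarrow> \<bar>f a\<bar> = 1"
  shows "even (sum f A) \<longleftrightarrow> even (card A)"
  using assms
proof (induction A)
  case (insert a A)
  have "f a = 1 \<or> f a = -1"
    using insert.prems[of a] by auto
  then have "odd (f a)"
    by auto
  then show ?case
    using insert by simp
qed simp

text \<open>A switching is encoded by a sign at every vertex. For an edge, \<open>prod s e\<close>
  is the product of the signs of its two ends, so for signs the score is the number of positive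
  edges minus the number of negative edges after switching.\<close>

definition score :: "('a set \<Rightarrow> int) \<Rightarrow> ('a \<Rightarrow> int) \<Rightarrow> 'a set set \<Rightarrow> int" where
  "score \<sigma> s E = (\<Sum>e\<in>E. \<sigma> e * prod s e)"

lemma score_Un:
  "finite E \<Longrightarrow> finite F \<Longrightarrow> E \<inter> F = {} \<Longrightarrow> score \<sigma> s (E \<union> F) = score \<sigma> s E + score \<sigma> s F"
  by (simp add: score_def sum.union_disjoint)

lemma abs_prod_units:
  fixes s :: "'a \<Rightarrow> int"
  assumes "\<And>v. \<bar>s v\<bar> = 1"
  shows "\<bar>prod s e\<bar> = 1"
  by (induction e rule: infinite_finite_induct) (simp_all add: abs_mult assms)

lemma even_score:
  assumes "finite E" "\<And>e. e \<in> E \<Longrightarrow> \<bar>\<sigma> e\<bar> = 1" "\<And>v. \<bar>s v\<bar> = 1"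
  shows "even (score \<sigma> s E) \<longleftrightarrow> even (card E)"
  unfolding score_def
  by (rule even_sum_units) (use assms in \<open>auto simp: abs_mult abs_prod_units\<close>)

text \<open>The edges at \<open>u\<close> contribute a sum of signs, which the sign of \<open>u\<close> makes nonnegative, and
  positive if there is an odd number of them.\<close>

lemma extend_vertex:
  assumes "finite E" "\<And>e. e \<in> E \<Longrightarrow> finite e" "\<And>e. e \<in> E \<Longrightarrow> \<bar>\<sigma> e\<bar> = 1" "\<And>v. \<bar>s v\<bar> = 1"
  obtains s' where "\<And>v. \<bar>s' v\<bar> = 1"
    "score \<sigma> s' E \<ge> score \<sigma> s {e\<in>E. u \<notin> e} + int (card {e\<in>E. u \<in> e} mod 2)"
proof -
  define R where "R = (\<Sum>e\<in>{e\<in>E. u \<in> e}. \<sigma> e * prod s (e - {u}))"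
  define t where "t = (if R \<ge> 0 then 1 else -1 :: int)"
  define s' where "s' = s(u := t)"
  have "E = {e\<in>E. u \<notin> e} \<union> {e\<in>E. u \<in> e}"
    by blast
  then have "score \<sigma> s' E = score \<sigma> s' {e\<in>E. u \<notin> e} + score \<sigma> s' {e\<in>E. u \<in> e}"
    using score_Un[of "{e\<in>E. u \<notin> e}" "{e\<in>E. u \<in> e}" \<sigma> s'] assms(1) by auto
  moreover have "score \<sigma> s' {e\<in>E. u \<notin> e} = score \<sigma> s {e\<in>E. u \<notin> e}"
    unfolding score_def s'_def by (intro sum.cong refl arg_cong2[where f = "(*)"] prod.cong) auto
  moreover have "score \<sigma> s' {e\<in>E. u \<in> e} = t * R"
    unfolding score_def R_def sum_distrib_left
  proof (rule sum.cong[OF refl])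
    fix e assume e: "e \<in> {e\<in>E. u \<in> e}"
    then have "prod s' e = t * prod s' (e - {u})"
      using assms(2) by (subst prod.remove[of _ u]) (auto simp: s'_def)
    also have "prod s' (e - {u}) = prod s (e - {u})"
      by (rule prod.cong) (auto simp: s'_def)
    finally show "\<sigma> e * prod s' e = t * (\<sigma> e * prod s (e - {u}))"
      by simp
  qed
  moreover have "even R \<longleftrightarrow> even (card {e\<in>E. u \<in> e})"
    unfolding R_def by (rule even_sum_units) (use assms in \<open>auto simp: abs_mult abs_prod_units\<close>)
  then have "t * R \<ge> int (card {e\<in>E. u \<in> e} mod 2)"
    by (cases "even R") (auto simp: t_def odd_iff_mod_2_eq_one, presburger+)
  moreover have "\<bar>s' v\<bar> = 1" for v
    using assms(4) by (simp add: s'_def t_def)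
  ultimately show thesis
    using that by fastforce
qed

text \<open>Delete the edges that are negative after switching by \<open>s\<close>. On each
  remaining edge the signature is the product of the signs of the two ends, and along a cycle every
  vertex sign occurs twice, so the rest is balanced. The right-hand side is twice the number of
  deleted edges.\<close>

lemma frustration_index_le:
  assumes "simple_graph G" "\<And>e. e \<in> edges G \<Longrightarrow> \<bar>\<sigma> e\<bar> = 1" "\<And>v. \<bar>s v\<bar> = 1"
  shows "2 * int (frustration_index G \<sigma>) \<le> int (card (edges G)) - score \<sigma> s (edges G)"
proof -
  define D where "D = {e \<in> edges G. \<sigma> e * prod s e = -1}"
  have fin: "finite (edges G)"
    using assms(1) by (rule finite_edges)
  have sq: "s v * s v = 1" for v
    using assms(3)[of v] by (metis abs_mult_self_eq mult_1)
  have unit: "\<sigma> e * prod s e = 1" if "e \<in> edges G - D" for e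
  proof -
    have "\<bar>\<sigma> e * prod s e\<bar> = 1"
      using that assms(2,3) by (simp add: abs_mult abs_prod_units)
    then show ?thesis
      using that by (auto simp: D_def abs_if split: if_splits)
  qed
  have "cycle_sign (restrict \<sigma> (edges G - D)) c = 1" if c: "is_cycle (delete_edges G D) c" for c
  proof -
    obtain m where m: "length c = Suc m" "m \<ge> 2"
      using c by (cases "length c") (auto simp: is_cycle_def)
    have edge: "restrict \<sigma> (edges G - D) (cycle_edge c i) = s (c ! i) * s (c ! (Suc i mod length c))"
      if i: "i < length c" for i
    proof -
      have mem: "cycle_edge c i \<in> edges G - D"
        using c i by (auto simp: is_cycle_def delete_edges_def)
      then have "card (cycle_edge c i) = 2"
        using assms(1) by (auto simp: simple_graph_def)
      then have "c ! i \<noteq> c ! (Suc i mod length c)"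
        by (auto simp: cycle_edge_def)
      then have "prod s (cycle_edge c i) = s (c ! i) * s (c ! (Suc i mod length c))"
        by (simp add: cycle_edge_def)
      moreover have "\<sigma> (cycle_edge c i) = prod s (cycle_edge c i)"
        using unit[OF mem] assms(2)[of "cycle_edge c i"] mem by (auto simp: zmult_eq_1_iff)
      ultimately show ?thesis
        using mem by simp
    qed
    \<comment> \<open>Only the last index \<open>m\<close> wraps around to 0; the others are shifted
      by one.\<close>
    have "(\<Prod>i<length c. s (c ! (Suc i mod length c))) = (\<Prod>i<m. s (c ! Suc i)) * s (c ! 0)"
      using m by simp
    also have "\<dots> = (\<Prod>i<length c. s (c ! i))"
      by (simp only: m(1) prod.lessThan_Suc_shift mult.commute)
    finally have shift: "(\<Prod>i<length c. s (c ! (Suc i mod length c))) = (\<Prod>i<length c. s (c ! i))" .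
    have "cycle_sign (restrict \<sigma> (edges G - D)) c
        = (\<Prod>i<length c. s (c ! i) * s (c ! (Suc i mod length c)))"
      unfolding cycle_sign_def by (rule prod.cong) (auto simp: edge simp del: restrict_apply)
    also have "\<dots> = (\<Prod>i<length c. s (c ! i) * s (c ! i))"
      by (simp only: prod.distrib shift)
    finally show ?thesis
      by (simp add: sq)
  qed
  then have "balanced (delete_edges G D) (restrict \<sigma> (edges G - D))"
    by (simp add: balanced_def)
  then have "frustration_index G \<sigma> \<le> card D"
    unfolding frustration_index_def
    by (intro Min_le frustration_index_well_defined(1)[OF assms(1)]) (auto simp: D_def)
  moreover have "score \<sigma> s (edges G) = int (card (edges G)) - 2 * int (card D)"
  proof -
    have "D \<subseteq> edges G"
      by (auto simp: D_def)
    then have "score \<sigma> s (edges G) = score \<sigma> s (edges G - D) + score \<sigma> s D"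
      using score_Un[of "edges G - D" D \<sigma> s] fin
      by (metis Diff_disjoint Diff_partition finite_Diff finite_subset inf_commute sup_commute)
    also have "score \<sigma> s (edges G - D) = int (card (edges G - D))"
      by (simp add: score_def unit)
    also have "score \<sigma> s D = - int (card D)"
      by (simp add: score_def D_def)
    finally show ?thesis
      using \<open>D \<subseteq> edges G\<close> fin by (simp add: card_Diff_subset finite_subset card_mono of_nat_diff)
  qed
  ultimately show ?thesis
    by linarith
qed

text \<open>Mantel's theorem, by removing both ends of an edge. Without triangles every other vertex
  is joined to at most one of the ends, so at most \<open>card W + 1\<close> edges are lost, where
  \<open>W\<close> is the set of remaining vertices; and with w vertices in \<open>W\<close>, w^2 +
  4 * (w + 1) = (w + 2)^2.\<close>

lemma mantel:
  assumes "finite V" "\<And>e. e \<in> F \<Longrightarrow> e \<subseteq> V \<and> card e = 2"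
    and "\<And>u v w. {u, v} \<in> F \<Longrightarrow> {v, w} \<in> F \<Longrightarrow> {u, w} \<in> F \<Longrightarrow> False"
  shows "4 * card F \<le> (card V)\<^sup>2"
  using assms
proof (induction "card V" arbitrary: V F rule: less_induct)
  case less
  have fin: "finite F"
    by (rule finite_subset[of _ "Pow V"]) (use less.prems in auto)
  show ?case
  proof (cases "F = {}")
    case False
    then obtain u v where uv: "{u, v} \<in> F" "u \<noteq> v"
      using less.prems(2) by (metis card_2_iff ex_in_conv)
    define W where "W = V - {u, v}"
    define M where "M = {e \<in> F. e \<inter> {u, v} \<noteq> {} \<and> e \<noteq> {u, v}}"
    define F' where "F' = {e \<in> F. e \<subseteq> W}"
    have W: "finite W" "u \<notin> W" "v \<notin> W" "V = insert u (insert v W)"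
      using less.prems(1) less.prems(2)[OF uv(1)] by (auto simp: W_def)
    then have V: "card V = card W + 2"
      using uv(2) by simp
    \<comment> \<open>The map picks for each \<open>w\<close> the only edge that can join it to
      \<open>u\<close> or \<open>v\<close>. Values that are not edges do no harm, as only an upper
      bound for \<open>card M\<close> is wanted.\<close>
    have "M \<subseteq> (\<lambda>w. if {u, w} \<in> F then {u, w} else {v, w}) ` W"
    proof
      fix e assume e: "e \<in> M"
      then have "card e = 2" "e \<subseteq> V"
        using less.prems(2) by (auto simp: M_def)
      then obtain x w where xw: "e = {x, w}" "x \<in> {u, v}" "w \<noteq> x"
        using e by (auto simp: M_def card_2_iff)
      then have "w \<in> W"
        using e \<open>e \<subseteq> V\<close> by (auto simp: M_def W_def)
      moreover have "\<not> ({u, w} \<in> F \<and> {v, w} \<in> F)"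
        using less.prems(3)[of u v w] uv by blast
      ultimately show "e \<in> (\<lambda>w. if {u, w} \<in> F then {u, w} else {v, w}) ` W"
        using e xw by (auto simp: M_def image_iff intro!: bexI[of _ w])
    qed
    then have "card M \<le> card W"
      using W(1) by (meson card_image_le card_mono finite_imageI order_trans)
    moreover have "4 * card F' \<le> (card W)\<^sup>2"
      by (rule less.hyps) (use V W(1) less.prems in \<open>auto simp: F'_def\<close>)
    moreover have "F = insert {u, v} (M \<union> F')"
      using uv less.prems(2) by (auto simp: M_def F'_def W_def)
    then have "card F \<le> Suc (card M + card F')"
      by (metis card_Un_le card_insert_le_m1 card_insert_if fin finite_insert Suc_le_mono le_SucI)
    ultimately show ?thesis
      unfolding V by (simp add: power2_eq_square algebra_simps)
  qed simp
qed

section \<open>Complete split graphs\<close>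

text \<open>The clique may live on any set \<open>A\<close>, since the bounds start from three or
  five suitably chosen clique vertices and then add the others one by one.\<close>

definition split_edges :: "'a set \<Rightarrow> ('a + nat) set set" where
  "split_edges A = edges (join (complete_graph A) (edgeless_graph {..<3}))"

lemma edges_complete_split: "edges (complete_split n 3) = split_edges {..<n}"
  by (simp add: split_edges_def complete_split_def)

lemma split_edges_cases:
  assumes "e \<in> split_edges A"
  obtains i j where "i \<in> A" "j \<in> A" "i \<noteq> j" "e = {Inl i, Inl j}"
    | i k where "i \<in> A" "k < 3" "e = {Inl i, Inr k}"
  using assms by (auto simp: split_edges_def join_def complete_graph_def edgeless_graph_def card_2_iff)

lemma split_edges_Inl: "i \<in> A \<Longrightarrow> j \<in> A \<Longrightarrow> i \<noteq> j \<Longrightarrow> {Inl i, Inl j} \<in> split_edges A"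
  unfolding split_edges_def join_def complete_graph_def
  by (auto simp: card_2_iff intro!: image_eqI[of _ _ "{i, j}"])

lemma split_edges_Inr: "i \<in> A \<Longrightarrow> k < 3 \<Longrightarrow> {Inl i, Inr k} \<in> split_edges A"
  by (auto simp: split_edges_def join_def complete_graph_def edgeless_graph_def)

lemma split_edges_mono: "A \<subseteq> B \<Longrightarrow> split_edges A \<subseteq> split_edges B"
  by (auto elim!: split_edges_cases intro: split_edges_Inl split_edges_Inr)

lemma finite_split_edge: "e \<in> split_edges A \<Longrightarrow> finite e"
  by (auto elim: split_edges_cases)

lemma finite_split_edges: "finite A \<Longrightarrow> finite (split_edges A)"
  unfolding split_edges_def
  by (intro finite_edges simple_graph_join simple_graph_complete_graph simple_graph_edgeless_graph) simp_all

lemma split_edges_empty: "split_edges {} = {}"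
  by (auto elim: split_edges_cases)

lemma split_edges_remove: "{e \<in> split_edges (insert i B). Inl i \<notin> e} = split_edges (B - {i})"
  by (auto elim!: split_edges_cases intro: split_edges_Inl split_edges_Inr)

section \<open>Edge counts and scores when a clique vertex is added\<close>

lemma split_edges_insert:
  "split_edges (insert i B) = split_edges (B - {i})
     \<union> ((\<lambda>j. {Inl j, Inl i}) ` (B - {i}) \<union> (\<lambda>k. {Inl i, Inr k}) ` {..<3})"
  (is "?L = ?R")
proof
  show "?L \<subseteq> ?R"
    by (auto elim!: split_edges_cases intro: split_edges_Inl split_edges_Inr)
  show "?R \<subseteq> ?L"
    using split_edges_mono[of "B - {i}" "insert i B"]
    by (auto intro!: split_edges_Inl split_edges_Inr)
qed

lemma score_split_edges_insert:
  assumes "finite B" "i \<notin> B"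
  shows "score \<sigma> s (split_edges (insert i B)) = score \<sigma> s (split_edges B)
    + (\<Sum>j\<in>B. \<sigma> {Inl j, Inl i} * (s (Inl j) * s (Inl i)))
    + (\<Sum>k<3. \<sigma> {Inl i, Inr k} * (s (Inl i) * s (Inr k)))"
proof -
  have "inj_on (\<lambda>j. {Inl j, Inl i :: 'a + nat}) B" "inj_on (\<lambda>k. {Inl i :: 'a + nat, Inr k}) {..<3}"
    by (auto simp: inj_on_def doubleton_eq_iff)
  moreover have "prod s {Inl j, Inl i} = s (Inl j) * s (Inl i)" if "j \<in> B" for j
    using that assms(2) by (subst prod.insert) auto
  ultimately have "score \<sigma> s ((\<lambda>j. {Inl j, Inl i}) ` B) = (\<Sum>j\<in>B. \<sigma> {Inl j, Inl i} * (s (Inl j) * s (Inl i)))"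
    and "score \<sigma> s ((\<lambda>k. {Inl i, Inr k}) ` {..<3})
      = (\<Sum>k<3. \<sigma> {Inl i, Inr k} * (s (Inl i) * s (Inr k)))"
    using assms by (auto simp: score_def sum.reindex intro!: sum.cong)
  moreover have "split_edges (insert i B) = split_edges B
     \<union> ((\<lambda>j. {Inl j, Inl i}) ` B \<union> (\<lambda>k. {Inl i, Inr k}) ` {..<3})"
    using assms split_edges_insert[of i B] by simp
  moreover have "Inl i \<notin> e" if "e \<in> split_edges B" for e
    using that assms(2) by (auto elim: split_edges_cases)
  then have "split_edges B \<inter> ((\<lambda>j. {Inl j, Inl i}) ` B \<union> (\<lambda>k. {Inl i, Inr k}) ` {..<3}) = {}"
    by blast
  moreover have "(\<lambda>j. {Inl j, Inl i}) ` B \<inter> (\<lambda>k. {Inl i, Inr k}) ` {..<3 :: nat} = {}"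
    by (auto simp: doubleton_eq_iff)
  ultimately show ?thesis
    using assms by (simp add: score_Un finite_split_edges)
qed

lemma card_split_edges_insert:
  assumes "finite B" "i \<notin> B"
  shows "card (split_edges (insert i B)) = card (split_edges B) + card B + 3"
proof -
  \<comment> \<open>With all signs equal to 1 the score counts edges, so the formula for scores
    yields the count.\<close>
  have "int (card E) = score (\<lambda>_. 1) (\<lambda>_. 1) E" for E :: "('a + nat) set set"
    by (simp add: score_def)
  then have "int (card (split_edges (insert i B))) = int (card (split_edges B) + card B + 3)"
    using score_split_edges_insert[OF assms, of "\<lambda>_. 1" "\<lambda>_. 1"] by simp
  then show ?thesis
    by simp
qed

lemma card_split_edges: "finite A \<Longrightarrow> 2 * card (split_edges A) = (card A)\<^sup>2 + 5 * card A"
  by (induction A rule: finite_induct)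
    (auto simp: split_edges_empty card_split_edges_insert power2_eq_square)

lemma score_split_edges_enum:
  fixes n :: nat
  assumes "inj_on v {..<n}"
  shows "score \<sigma> s (split_edges (v ` {..<n}))
    = (\<Sum>j<n. \<Sum>i<j. \<sigma> {Inl (v i), Inl (v j)} * (s (Inl (v i)) * s (Inl (v j))))
    + (\<Sum>i<n. \<Sum>k<3. \<sigma> {Inl (v i), Inr k} * (s (Inl (v i)) * s (Inr k)))"
  using assms
proof (induction n)
  case (Suc n)
  then have inj: "inj_on v {..<n}" and notin: "v n \<notin> v ` {..<n}"
    by (auto simp: lessThan_Suc)
  then show ?case
    using Suc.IH[OF inj] score_split_edges_insert[OF _ notin, of \<sigma> s]
    by (simp add: lessThan_Suc[of n] sum.reindex)
qed (simp add: split_edges_empty score_def)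

text \<open>A vertex added to b clique vertices has degree b + 3, which is odd exactly for even b.
  As \<open>c\<close> is odd, these are exactly the steps at which \<open>(b + c) div 2\<close>
  grows, so \<open>extend_vertex\<close> preserves the bound.\<close>

lemma extend_score:
  assumes "finite A" "B \<subseteq> A" "\<And>e. e \<in> split_edges A \<Longrightarrow> \<bar>\<sigma> e\<bar> = 1" "\<And>v. \<bar>s v\<bar> = 1"
    and "score \<sigma> s (split_edges B) \<ge> int ((card B + c) div 2)" "odd c"
  obtains s' where "\<And>v. \<bar>s' v\<bar> = 1" "score \<sigma> s' (split_edges A) \<ge> int ((card A + c) div 2)"
proof -
  have "\<exists>s'. (\<forall>v. \<bar>s' v\<bar> = 1) \<and> score \<sigma> s' (split_edges (B \<union> C)) \<ge> int ((card (B \<union> C) + c) div 2)"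
    if "finite C" "C \<subseteq> A - B" for C
    using that
  proof (induction C rule: finite_subset_induct')
    case empty
    show ?case
      using assms(4,5) by auto
  next
    case (insert i C)
    then obtain s where s: "\<And>v. \<bar>s v\<bar> = 1"
        "score \<sigma> s (split_edges (B \<union> C)) \<ge> int ((card (B \<union> C) + c) div 2)"
      by auto
    have i: "i \<notin> B \<union> C" "finite (B \<union> C)"
      using insert assms(1,2) by (auto intro: finite_subset)
    define E where "E = split_edges (insert i (B \<union> C))"
    have "finite E" "\<And>e. e \<in> E \<Longrightarrow> finite e"
      using i(2) by (auto simp: E_def finite_split_edges finite_split_edge)
    moreover have "E \<subseteq> split_edges A"
      unfolding E_def by (rule split_edges_mono) (use insert assms(2) in auto)
    then have "\<And>e. e \<in> E \<Longrightarrow> \<bar>\<sigma> e\<bar> = 1"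
      using assms(3) by blast
    ultimately obtain s' where s': "\<And>v. \<bar>s' v\<bar> = 1"
      "score \<sigma> s' E \<ge> score \<sigma> s {e\<in>E. Inl i \<notin> e} + int (card {e\<in>E. Inl i \<in> e} mod 2)"
      using s(1) extend_vertex[of E \<sigma> s "Inl i"] by blast
    have rest: "{e\<in>E. Inl i \<notin> e} = split_edges (B \<union> C)"
      using i(1) by (simp add: E_def split_edges_remove)
    have "card E = card {e\<in>E. Inl i \<notin> e} + card {e\<in>E. Inl i \<in> e}"
      using \<open>finite E\<close> by (subst card_Un_disjoint[symmetric]) (auto intro: arg_cong[where f = card])
    then have "card {e\<in>E. Inl i \<in> e} = card (B \<union> C) + 3"
      using card_split_edges_insert[OF i(2,1)] rest by (simp add: E_def)
    moreover have "(card (B \<union> C) + 1 + c) div 2 = (card (B \<union> C) + c) div 2 + (card (B \<union> C) + 3) mod 2"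
      using \<open>odd c\<close> by presburger
    ultimately have "score \<sigma> s' E \<ge> int ((card (insert i (B \<union> C)) + c) div 2)"
      using s(2) s'(2) rest i by simp
    then show ?case
      using s'(1) by (auto simp: E_def)
  qed
  from this[of "A - B"] obtain s' where "\<forall>v. \<bar>s' v\<bar> = 1"
      "score \<sigma> s' (split_edges (B \<union> (A - B))) \<ge> int ((card (B \<union> (A - B)) + c) div 2)"
    using assms(1) by auto
  moreover have "B \<union> (A - B) = A"
    using assms(2) by blast
  ultimately show thesis
    using that by auto
qed

section \<open>Signatures whose triangles through independent vertices are all negative\<close>

definition negative_triangles :: "(('a + nat) set \<Rightarrow> int) \<Rightarrow> 'a set \<Rightarrow> bool" where
  "negative_triangles \<sigma> A \<longleftrightarrow> (\<forall>i\<in>A. \<forall>j\<in>A. \<forall>k<3. i \<noteq> j \<longrightarrow>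
     \<sigma> {Inl i, Inl j} * \<sigma> {Inl i, Inr k} * \<sigma> {Inl j, Inr k} = -1)"

text \<open>Switching by \<open>g\<close> makes every edge negative: the triangles through
  independent vertices alone already determine the signature up to switching.\<close>

lemma negative_potential:
  assumes "negative_triangles \<sigma> A" "a \<in> A" "\<And>e. e \<in> split_edges A \<Longrightarrow> \<bar>\<sigma> e\<bar> = 1"
  obtains g where "\<And>v. \<bar>g v\<bar> = 1"
    "\<And>i j. i \<in> A \<Longrightarrow> j \<in> A \<Longrightarrow> i \<noteq> j \<Longrightarrow> \<sigma> {Inl i, Inl j} * (g (Inl i) * g (Inl j)) = -1"
    "\<And>i k. i \<in> A \<Longrightarrow> k < 3 \<Longrightarrow> \<sigma> {Inl i, Inr k} * (g (Inl i) * g (Inr k)) = -1"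
proof -
  define w where "w i k = \<sigma> {Inl i, Inr k}" for i and k :: nat
  \<comment> \<open>Each clique vertex takes its sign towards the independent vertex 0, and
    \<open>Inr k\<close> takes the sign that makes its edge to \<open>a\<close> negative. The value
    1 elsewhere only keeps \<open>g\<close> a sign on the whole type.\<close>
  define g where "g v = (case v of
      Inl i \<Rightarrow> if i \<in> A then w i 0 else 1
    | Inr k \<Rightarrow> if k < 3 then - (w a k * w a 0) else 1)" for v
  have w: "\<bar>w i k\<bar> = 1" if "i \<in> A" "k < 3" for i k
    using that assms(3) by (simp add: w_def split_edges_Inr)
  have sq: "w i k * w i k = 1" if "i \<in> A" "k < 3" for i k
    using w[OF that] by (metis abs_mult_self_eq mult_1)
  have tri: "\<sigma> {Inl i, Inl j} * w i k * w j k = -1" if "i \<in> A" "j \<in> A" "i \<noteq> j" "k < 3" for i j k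
    using assms(1) that by (auto simp: negative_triangles_def w_def)
  show thesis
  proof (rule that[of g])
    show "\<bar>g v\<bar> = 1" for v
      using w assms(2) by (auto simp: g_def abs_mult split: sum.split)
    show "\<sigma> {Inl i, Inl j} * (g (Inl i) * g (Inl j)) = -1" if "i \<in> A" "j \<in> A" "i \<noteq> j" for i j
      using tri[OF that, of 0] that by (simp add: g_def mult.assoc)
    show "\<sigma> {Inl i, Inr k} * (g (Inl i) * g (Inr k)) = -1" if i: "i \<in> A" and k: "k < 3" for i k
    proof -
      \<comment> \<open>The 4-cycle through \<open>i\<close>, \<open>k\<close>, \<open>a\<close> and
        0 is positive, being composed of two negative triangles that share the edge from
        \<open>i\<close> to \<open>a\<close>.\<close>
      have "w i k * w i 0 * (w a k * w a 0) = 1"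
      proof (cases "i = a")
        case True
        then show ?thesis
          using sq[OF i k] sq[OF i, of 0] by (simp add: ac_simps)
      next
        case False
        define z where "z = \<sigma> {Inl i, Inl a}"
        have "\<bar>z\<bar> = 1"
          using assms(2,3) i False by (simp add: z_def split_edges_Inl)
        then have "z * z = 1"
          by (metis abs_mult_self_eq mult_1)
        then have "w i k * w i 0 * (w a k * w a 0) = (z * w i k * w a k) * (z * w i 0 * w a 0)"
          by (simp add: ac_simps)
        also have "\<dots> = 1"
          using tri[OF i assms(2) False] k by (simp add: z_def)
        finally show ?thesis .
      qed
      then show ?thesis
        using i k by (simp add: g_def w_def[symmetric] ac_simps)
    qed
  qed
qed

text \<open>Once all edges are negative, negating the three independent vertices makes the 9 edges
  at them positive and leaves 3 negative clique edges: 9 - 3 = 6.\<close>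

lemma score_negative_triangles:
  assumes "card A = 3" "negative_triangles \<sigma> A" "\<And>e. e \<in> split_edges A \<Longrightarrow> \<bar>\<sigma> e\<bar> = 1"
  obtains s where "\<And>v. \<bar>s v\<bar> = 1" "score \<sigma> s (split_edges A) = 6"
proof -
  obtain v where v: "bij_betw v {..<3::nat} A"
    using assms(1) by (metis card.infinite card_lessThan finite_lessThan finite_same_card_bij zero_neq_numeral)
  then have inj: "inj_on v {..<3}" and A: "v ` {..<3} = A"
    by (auto simp: bij_betw_def)
  have vA: "v i \<in> A" if "i < 3" for i
    using A that by blast
  obtain g where g: "\<And>v. \<bar>g v\<bar> = 1"
    "\<And>i j. i \<in> A \<Longrightarrow> j \<in> A \<Longrightarrow> i \<noteq> j \<Longrightarrow> \<sigma> {Inl i, Inl j} * (g (Inl i) * g (Inl j)) = -1"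
    "\<And>i k. i \<in> A \<Longrightarrow> k < 3 \<Longrightarrow> \<sigma> {Inl i, Inr k} * (g (Inl i) * g (Inr k)) = -1"
    using negative_potential[OF assms(2) vA[of 0] assms(3)] by auto
  define s where "s v = (case v of Inl i \<Rightarrow> g (Inl i) | Inr k \<Rightarrow> - g (Inr k))" for v
  have "(\<Sum>j<3. \<Sum>i<j. \<sigma> {Inl (v i), Inl (v j)} * (s (Inl (v i)) * s (Inl (v j)))) = (\<Sum>j<3::nat. \<Sum>i<j. -1)"
  proof (intro sum.cong refl)
    fix i j :: nat assume "j \<in> {..<3}" "i \<in> {..<j}"
    then have "v i \<noteq> v j" "i < 3" "j < 3"
      using inj by (auto dest: inj_onD)
    then show "\<sigma> {Inl (v i), Inl (v j)} * (s (Inl (v i)) * s (Inl (v j))) = -1"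
      using g(2) vA by (simp add: s_def)
  qed
  moreover have "(\<Sum>i<3. \<Sum>k<3. \<sigma> {Inl (v i), Inr k} * (s (Inl (v i)) * s (Inr k))) = (\<Sum>i<3::nat. \<Sum>k<3::nat. 1)"
    by (intro sum.cong refl) (use g(3) vA in \<open>auto simp: s_def\<close>)
  ultimately have "score \<sigma> s (split_edges A) = 6"
    using score_split_edges_enum[OF inj, of \<sigma> s] A by (simp add: eval_nat_numeral)
  moreover have "\<bar>s v\<bar> = 1" for v
    using g(1) by (auto simp: s_def split: sum.split)
  ultimately show thesis
    using that by blast
qed

text \<open>If no score reached 9, the normalised signature would satisfy
  \<open>five_vertices\<close> for every ordering of \<open>A\<close>. The sizes of the type classes
  are then distinguished: every non-uniform pattern is contradictory, and the uniform one makes all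
  these triangles negative.\<close>

lemma five_vertices_positive_triangle:
  assumes "card A = 5" "\<not> negative_triangles \<sigma> A" "\<And>e. e \<in> split_edges A \<Longrightarrow> \<bar>\<sigma> e\<bar> = 1"
  shows "\<exists>s. (\<forall>v. \<bar>s v\<bar> = 1) \<and> score \<sigma> s (split_edges A) \<ge> 9"
proof (rule ccontr)
  assume contra: "\<not> ?thesis"
  have fin: "finite A"
    using assms(1) by (metis card.infinite zero_neq_numeral)
  have le: "score \<sigma> s (split_edges A) \<le> 7" if "\<And>v. \<bar>s v\<bar> = 1" for s
  proof -
    \<comment> \<open>The number of edges is odd, hence so is every score, and a score below 9 is at
      most 7.\<close>
    have "card (split_edges A) = 25"
      using card_split_edges[OF fin] assms(1) by simp
    then have "odd (score \<sigma> s (split_edges A))"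
      using even_score[OF finite_split_edges[OF fin] assms(3) that] by simp
    moreover have "\<not> score \<sigma> s (split_edges A) \<ge> 9"
      using contra that by blast
    ultimately show ?thesis
      by presburger
  qed
  define w where "w k i = \<sigma> {Inl i, Inr k}" for k :: nat and i
  \<comment> \<open>Switching \<open>i\<close> by \<open>g i\<close> gives its triple product 1. The
    pair \<open>f i\<close> consists of the third and second entries of this normalised triple,
    which determine the first.\<close>
  define g where "g i = w 0 i * w 1 i * w 2 i" for i
  define f where "f i = (w 0 i * w 1 i, w 0 i * w 2 i)" for i
  define T where "T = {1, -1 :: int} \<times> {1, -1 :: int}"
  have w: "w k i = 1 \<or> w k i = -1" if "i \<in> A" "k < 3" for i k
    using that assms(3)[of "{Inl i, Inr k}"] by (auto simp: w_def split_edges_Inr abs_if split: if_splits)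
  have w012: "w 0 i = 1 \<or> w 0 i = -1" "w 1 i = 1 \<or> w 1 i = -1" "w 2 i = 1 \<or> w 2 i = -1"
    if "i \<in> A" for i
    using that w by simp_all
  have card_T: "card T = 4" "finite T"
    by (simp_all add: T_def)
  have f_in: "f i \<in> T" if "i \<in> A" for i
    using w012[OF that] by (auto simp: f_def T_def)
  have g_unit: "\<bar>g i\<bar> = 1" if "i \<in> A" for i
    using w012[OF that] by (auto simp: g_def)
  \<comment> \<open>The enumeration is arbitrary, so that later the vertices can be listed type by
    type.\<close>
  have five: "five_vertices (\<lambda>i j. \<sigma> {Inl (xs ! i), Inl (xs ! j)} * (g (xs ! i) * g (xs ! j)))
      (\<lambda>i. f (xs ! i)) T" if "distinct xs" "set xs = A" for xs
  proof
    have len: "length xs = 5"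
      using that assms(1) distinct_card by fastforce
    then have inj: "inj_on ((!) xs) {..<5}" and img: "(!) xs ` {..<5} = A"
      using that inj_on_nth[of xs "{..<5}"] nth_image[of 5 xs] by (auto simp: lessThan_atLeast0)
    have mem: "xs ! i \<in> A" if "i < 5" for i
      using img that by blast
    show "f (xs ! i) \<in> T" if "i < 5" for i
      using f_in mem that by blast
    show "card T = 4"
      by fact
    show "\<bar>\<sigma> {Inl (xs ! i), Inl (xs ! j)} * (g (xs ! i) * g (xs ! j))\<bar> = 1" if "i < j" "j < 5" for i j
    proof -
      have "xs ! i \<noteq> xs ! j"
        using that inj by (auto dest: inj_onD)
      then show ?thesis
        using that assms(3) mem by (simp add: abs_mult g_unit split_edges_Inl)
    qed
    show "(\<Sum>j<5. \<Sum>i<j. \<sigma> {Inl (xs ! i), Inl (xs ! j)} * (g (xs ! i) * g (xs ! j)) * (x i * x j))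
        + (\<Sum>i<5. (if f (xs ! i) = t then 3 else - 1) * x i) \<le> 7"
      if t: "t \<in> T" and x: "\<And>i. i < 5 \<Longrightarrow> \<bar>x i\<bar> = 1" for x t
    proof -
      obtain p r where pr: "t = (p, r)" "p = 1 \<or> p = -1" "r = 1 \<or> r = -1"
        using t by (auto simp: T_def)
      define y where "y = (\<lambda>a. x (inv_into {..<5} ((!) xs) a))"
      \<comment> \<open>The independent vertices receive \<open>(p * r, r, p)\<close>, the
        normalised triple of type \<open>t\<close>. Its inner product with the triple of a clique
        vertex is 3 for type \<open>t\<close> and -1 otherwise.\<close>
      define s where "s v = (case v of
          Inl a \<Rightarrow> if a \<in> A then g a * y a else 1
        | Inr k \<Rightarrow> if k = 0 then p * r else if k = 1 then r else p)" for v :: "'a + nat"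
      have y: "y (xs ! i) = x i" if "i < 5" for i
        unfolding y_def using inv_into_f_f[OF inj] that by simp
      have "\<bar>y a\<bar> = 1" if "a \<in> A" for a
        using that img y x by (metis imageE lessThan_iff)
      then have "\<bar>s v\<bar> = 1" for v
        using pr g_unit by (auto simp: s_def abs_mult split: sum.split)
      then have "score \<sigma> s (split_edges A) \<le> 7"
        by (rule le)
      moreover have "(\<Sum>j<5. \<Sum>i<j. \<sigma> {Inl (xs ! i), Inl (xs ! j)} * (s (Inl (xs ! i)) * s (Inl (xs ! j))))
          = (\<Sum>j<5. \<Sum>i<j. \<sigma> {Inl (xs ! i), Inl (xs ! j)} * (g (xs ! i) * g (xs ! j)) * (x i * x j))"
        by (intro sum.cong refl) (simp add: s_def mem y)
      moreover have "(\<Sum>k<3. \<sigma> {Inl a, Inr k} * (s (Inl a) * s (Inr k)))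
          = (if f a = t then 3 else - 1) * y a" if "a \<in> A" for a
        using w012[OF that] pr that
        by (auto simp: eval_nat_numeral s_def g_def f_def w_def[symmetric])
      then have "(\<Sum>i<5. \<Sum>k<3. \<sigma> {Inl (xs ! i), Inr k} * (s (Inl (xs ! i)) * s (Inr k)))
          = (\<Sum>i<5. (if f (xs ! i) = t then 3 else - 1) * x i)"
        by (intro sum.cong refl) (simp add: mem y)
      ultimately show ?thesis
        using score_split_edges_enum[OF inj, of \<sigma> s] img by simp
    qed
  qed
  have five_elems: "five_vertices
      (\<lambda>i j. \<sigma> {Inl ([a, b, c, d, e] ! i), Inl ([a, b, c, d, e] ! j)} *
        (g ([a, b, c, d, e] ! i) * g ([a, b, c, d, e] ! j)))
      (\<lambda>i. f ([a, b, c, d, e] ! i)) T"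
    if "distinct [a, b, c, d, e]" "set [a, b, c, d, e] = A" for a b c d e
    by (rule five[OF that])
  define C where "C t = {a \<in> A. f a = t}" for t
  \<comment> \<open>List the clique ends \<open>i\<close>, \<open>j\<close> of a positive triangle
    first, so that \<open>uniform\<close> makes their normalised edge negative. Equal types mean
    triples equal up to a common sign, whence \<open>g i * g j = w k i * w k j\<close> and the
    triangle would be negative.\<close>
  have same: False if "t \<in> T" "C t = A" for t
  proof -
    obtain i j k where bad: "i \<in> A" "j \<in> A" "k < 3" "i \<noteq> j"
      "\<sigma> {Inl i, Inl j} * \<sigma> {Inl i, Inr k} * \<sigma> {Inl j, Inr k} \<noteq> -1"
      using assms(2) by (auto simp: negative_triangles_def)
    have "card (A - {i, j}) = 3" "finite (A - {i, j})"
      using bad assms(1) fin by (auto simp: card_Diff_subset)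
    then obtain xs where "distinct xs" "set xs = A - {i, j}" "length xs = 3"
      by (metis distinct_card finite_distinct_list)
    then obtain c d e where xs: "distinct [c, d, e]" "set [c, d, e] = A - {i, j}"
      by (auto simp: eval_nat_numeral length_Suc_conv)
    have A: "distinct [i, j, c, d, e]" "set [i, j, c, d, e] = A"
      using xs bad by auto
    have f_eq: "f a = t" if "a \<in> A" for a
      using \<open>C t = A\<close> that by (auto simp: C_def)
    have "f i = t" "f j = t" "f c = t" "f d = t" "f e = t"
      using f_eq A(2) by auto
    then have "\<sigma> {Inl i, Inl j} * (g i * g j) = -1"
      using five_vertices.uniform[OF five_elems[OF A]] by simp
    moreover have "g i * g j = w k i * w k j"
    proof -
      have "f i = f j"
        using f_eq bad by simp
      moreover have "k = 0 \<or> k = 1 \<or> k = 2"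
        using bad by auto
      ultimately show ?thesis
        using w012[OF bad(1)] w012[OF bad(2)] by (auto simp: f_def g_def)
    qed
    ultimately show False
      using bad(5) by (simp add: w_def mult.assoc)
  qed
  \<comment> \<open>A largest class has at least two members, as five vertices share four types, and
    fewer than five by \<open>same\<close>.\<close>
  obtain t where t: "t \<in> T" "\<And>u. u \<in> T \<Longrightarrow> card (C u) \<le> card (C t)"
  proof -
    have "T \<noteq> {}"
      by (simp add: T_def)
    then have "Max ((\<lambda>u. card (C u)) ` T) \<in> (\<lambda>u. card (C u)) ` T"
      using card_T(2) by (intro Max_in) auto
    then obtain t where "t \<in> T" "card (C t) = Max ((\<lambda>u. card (C u)) ` T)"
      by (metis imageE)
    then show thesis
      using that card_T(2) by simp
  qed
  have finC: "finite (C u)" "C u \<subseteq> A" for u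
    using fin by (auto simp: C_def)
  have "card (C t) < 5"
    using same[OF t(1)] finC[of t] fin assms(1) by (metis psubsetI psubset_card_mono)
  moreover have "card (C t) \<ge> 2"
  proof -
    have "A = (\<Union>u\<in>T. C u)"
      using f_in by (auto simp: C_def)
    then have "card A \<le> (\<Sum>u\<in>T. card (C u))"
      using card_UN_le[OF card_T(2), of C] by simp
    also have "\<dots> \<le> 4 * card (C t)"
      using sum_bounded_above[of T "\<lambda>u. card (C u)" "card (C t)"] t(2) card_T by simp
    finally show ?thesis
      using assms(1) by simp
  qed
  moreover obtain xs where xs: "distinct xs" "set xs = C t" "length xs = card (C t)"
    using finC by (metis distinct_card finite_distinct_list)
  moreover obtain ys where ys: "distinct ys" "set ys = A - C t" "length ys = 5 - card (C t)"
    using finC fin assms(1) by (metis card_Diff_subset distinct_card finite_Diff finite_distinct_list)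
  ultimately consider "length xs = 2" "length ys = 3" | "length xs = 3" "length ys = 2"
    | "length xs = 4" "length ys = 1"
    by fastforce
  then show False
  proof cases
    case 1
    then obtain a b c d e where ab: "xs = [a, b]" and cde: "ys = [c, d, e]"
      by (auto simp: eval_nat_numeral length_Suc_conv)
    have "distinct [a, b, c, d, e]" "set [a, b, c, d, e] = A"
      using xs ys finC[of t] by (auto simp: ab cde)
    \<comment> \<open>These orderings bring whichever two of \<open>c\<close>, \<open>d\<close>,
      \<open>e\<close> agree in type to the positions required by
      \<open>two_two_one\<close>.\<close>
    moreover from this have "distinct [a, b, c, e, d]" "set [a, b, c, e, d] = A"
      "distinct [a, b, d, e, c]" "set [a, b, d, e, c] = A"
      by auto
    moreover have f: "f a = t" "f b = t" "f c \<noteq> t" "f d \<noteq> t" "f e \<noteq> t"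
      using xs ys by (auto simp: ab cde C_def)
    \<comment> \<open>Three equal types would form a class larger than the maximal class
      \<open>C t\<close>.\<close>
    moreover have "\<not> (f c = f d \<and> f d = f e)"
    proof
      assume "f c = f d \<and> f d = f e"
      then have "{c, d, e} \<subseteq> C (f c)"
        using ys by (auto simp: cde C_def)
      then have "card {c, d, e} \<le> card (C (f c))"
        using finC by (intro card_mono)
      also have "\<dots> \<le> 2"
        using t(2)[of "f c"] f_in[of c] xs ys 1 by (auto simp: cde)
      finally show False
        using ys(1) by (simp add: cde)
    qed
    ultimately show False
      using five_vertices.two_two_one[OF five_elems, of a b c d e]
        five_vertices.two_two_one[OF five_elems, of a b c e d]
        five_vertices.two_two_one[OF five_elems, of a b d e c]
        five_vertices.two_one_one_one[OF five_elems, of a b c d e]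
      by (cases "f c = f d"; cases "f c = f e"; cases "f d = f e") (simp_all add: eq_commute)
  next
    case 2
    then obtain a b c d e where abc: "xs = [a, b, c]" and de: "ys = [d, e]"
      by (auto simp: eval_nat_numeral length_Suc_conv)
    have "distinct [a, b, c, d, e]" "set [a, b, c, d, e] = A"
      using xs ys finC[of t] by (auto simp: abc de)
    moreover have "f a = t" "f b = t" "f c = t" "f d \<noteq> t" "f e \<noteq> t"
      using xs ys by (auto simp: abc de C_def)
    ultimately show False
      using five_vertices.three_two[OF five_elems, of a b c d e]
        five_vertices.three_one_one[OF five_elems, of a b c d e]
      by (cases "f e = f d") simp_all
  next
    case 3
    then obtain a b c d e where abcd: "xs = [a, b, c, d]" and e: "ys = [e]"
      by (auto simp: eval_nat_numeral length_Suc_conv)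
    have "distinct [a, b, c, d, e]" "set [a, b, c, d, e] = A"
      using xs ys finC[of t] by (auto simp: abcd e)
    moreover have "f a = t" "f b = t" "f c = t" "f d = t" "f e \<noteq> t"
      using xs ys by (auto simp: abcd e C_def)
    ultimately show False
      using five_vertices.four_one[OF five_elems, of a b c d e] by simp
  qed
qed

text \<open>The constants 9 and 13 encode the starting values of \<open>extend_score\<close>: (3 +
  9) / 2 = 6 and (5 + 13) / 2 = 9.\<close>

lemma exists_signs_score:
  assumes "finite A" "card A \<ge> 5" "\<And>e. e \<in> split_edges A \<Longrightarrow> \<bar>\<sigma> e\<bar> = 1"
  obtains s where "\<And>v. \<bar>s v\<bar> = 1"
    "score \<sigma> s (split_edges A) \<ge> int ((card A + (if negative_triangles \<sigma> A then 9 else 13)) div 2)"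
proof (cases "negative_triangles \<sigma> A")
  case True
  obtain B where B: "B \<subseteq> A" "card B = 3"
    using assms(2) obtain_subset_with_card_n[of 3 A] by auto
  have unit: "\<And>e. e \<in> split_edges B \<Longrightarrow> \<bar>\<sigma> e\<bar> = 1"
    using split_edges_mono[OF B(1)] assms(3) by blast
  moreover have "negative_triangles \<sigma> B"
    using True B(1) by (auto simp: negative_triangles_def)
  ultimately obtain s where s: "\<And>v. \<bar>s v\<bar> = 1" "score \<sigma> s (split_edges B) = 6"
    using score_negative_triangles[OF B(2)] by metis
  then obtain s' where "\<And>v. \<bar>s' v\<bar> = 1" "score \<sigma> s' (split_edges A) \<ge> int ((card A + 9) div 2)"
    using extend_score[of A B \<sigma> s 9] assms(1,3) B by auto
  then show thesis
    using that[of s'] True by simp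
next
  case False
  then obtain i j k where ijk: "i \<in> A" "j \<in> A" "k < 3" "i \<noteq> j"
    "\<sigma> {Inl i, Inl j} * \<sigma> {Inl i, Inr k} * \<sigma> {Inl j, Inr k} \<noteq> -1"
    by (auto simp: negative_triangles_def)
  \<comment> \<open>\<open>B\<close> keeps the clique ends of a positive triangle, so the smaller
    graph still has one.\<close>
  obtain B where B: "{i, j} \<subseteq> B" "B \<subseteq> A" "card B = 5"
    using exists_subset_between[of "{i, j}" 5 A] assms(1,2) ijk by auto
  have unit: "\<And>e. e \<in> split_edges B \<Longrightarrow> \<bar>\<sigma> e\<bar> = 1"
    using split_edges_mono[OF B(2)] assms(3) by blast
  moreover have "\<not> negative_triangles \<sigma> B"
    using ijk B(1) by (auto simp: negative_triangles_def)
  ultimately obtain s where s: "\<And>v. \<bar>s v\<bar> = 1" "score \<sigma> s (split_edges B) \<ge> 9"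
    using five_vertices_positive_triangle[OF B(3)] by blast
  then obtain s' where "\<And>v. \<bar>s' v\<bar> = 1" "score \<sigma> s' (split_edges A) \<ge> int ((card A + 13) div 2)"
    using extend_score[of A B \<sigma> s 13] assms(1,3) B by auto
  then show thesis
    using that[of s'] False by simp
qed

section \<open>Bounds on the frustration index and the extremal switching class\<close>

lemma signature_unit: "\<sigma> \<in> signatures G \<Longrightarrow> e \<in> edges G \<Longrightarrow> \<bar>\<sigma> e\<bar> = 1"
  by (auto simp: signatures_def dest: PiE_mem)

lemma frustration_index_complete_split_le:
  assumes "n \<ge> 5" "\<sigma> \<in> signatures (complete_split n 3)"
  shows "frustration_index (complete_split n 3) \<sigma>
    \<le> (n\<^sup>2 + 4 * n - (if negative_triangles \<sigma> {..<n} then 8 else 12)) div 4"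
proof -
  have unit: "\<And>e. e \<in> split_edges {..<n} \<Longrightarrow> \<bar>\<sigma> e\<bar> = 1"
    using signature_unit[OF assms(2)] by (simp add: edges_complete_split)
  define c where "c = (if negative_triangles \<sigma> {..<n} then 9 else 13 :: nat)"
  obtain s where "\<And>v. \<bar>s v\<bar> = 1" "score \<sigma> s (split_edges {..<n}) \<ge> int ((n + c) div 2)"
    using exists_signs_score[of "{..<n}" \<sigma>] unit assms(1) by (auto simp: c_def)
  then have "2 * int (frustration_index (complete_split n 3) \<sigma>) \<le>
      int (card (split_edges {..<n})) - int ((n + c) div 2)"
    using frustration_index_le[OF simple_graph_complete_split, of n 3 \<sigma> s] unit
    by (simp add: edges_complete_split)
  moreover have "2 * card (split_edges {..<n}) = n\<^sup>2 + 5 * n"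
    using card_split_edges[of "{..<n}"] by simp
  ultimately have "4 * frustration_index (complete_split n 3) \<sigma> + 2 * ((n + c) div 2) \<le> n\<^sup>2 + 5 * n"
    by linarith
  \<comment> \<open>Rounding costs at most 1, which turns 9 and 13 into 8 and 12.\<close>
  moreover have "2 * ((n + c) div 2) + 1 \<ge> n + c"
    by linarith
  ultimately have "4 * frustration_index (complete_split n 3) \<sigma> + (c - 1) \<le> n\<^sup>2 + 4 * n"
    by (simp add: c_def)
  then show ?thesis
    by (auto simp: c_def less_eq_div_iff_mult_less_eq)
qed

lemma negative_triangles_switching_equivalent:
  assumes "n > 0" "\<sigma> \<in> signatures (complete_split n 3)" "negative_triangles \<sigma> {..<n}"
  shows "switching_equivalent (complete_split n 3) \<sigma> (all_negative (complete_split n 3))"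
proof -
  let ?G = "complete_split n 3"
  obtain g where g: "\<And>v. \<bar>g v\<bar> = 1"
    "\<And>i j. i < n \<Longrightarrow> j < n \<Longrightarrow> i \<noteq> j \<Longrightarrow> \<sigma> {Inl i, Inl j} * (g (Inl i) * g (Inl j)) = -1"
    "\<And>i k. i < n \<Longrightarrow> k < 3 \<Longrightarrow> \<sigma> {Inl i, Inr k} * (g (Inl i) * g (Inr k)) = -1"
    using negative_potential[OF assms(3), of 0] assms(1) signature_unit[OF assms(2)]
    by (auto simp: edges_complete_split)
  \<comment> \<open>Switching at the vertices with sign -1 multiplies each edge by the product of
    the signs of its ends.\<close>
  define X where "X = {v \<in> verts ?G. g v = -1}"
  have switched: "(if card ({u, v} \<inter> X) = 1 then - \<sigma> {u, v} else \<sigma> {u, v}) = -1"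
    if "u \<noteq> v" "u \<in> verts ?G" "v \<in> verts ?G" "\<sigma> {u, v} * (g u * g v) = -1" for u v
  proof -
    have "{u, v} \<inter> X = (if g u = -1 then {u} else {}) \<union> (if g v = -1 then {v} else {})"
      using that by (auto simp: X_def)
    moreover have "g u = 1 \<or> g u = -1" "g v = 1 \<or> g v = -1"
      using g(1)[of u] g(1)[of v] by linarith+
    ultimately show ?thesis
      using that by auto
  qed
  have "switch ?G X \<sigma> e = -1" if e: "e \<in> edges ?G" for e
    using e[unfolded edges_complete_split]
  proof (cases rule: split_edges_cases)
    case (1 i j)
    then show ?thesis
      using e switched[of "Inl i" "Inl j"] g(2)
      by (simp add: switch_def complete_split_def join_def complete_graph_def)
  next
    case (2 i k)
    then show ?thesis
      using e switched[of "Inl i" "Inr k"] g(3)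
      by (simp add: switch_def complete_split_def join_def complete_graph_def edgeless_graph_def)
  qed
  then have "all_negative ?G = switch ?G X \<sigma>"
    by (auto simp: all_negative_def switch_def fun_eq_iff restrict_def)
  moreover have "X \<subseteq> verts ?G"
    by (auto simp: X_def)
  ultimately show ?thesis
    unfolding switching_equivalent_def by blast
qed

text \<open>A triangle of negative edges is negative, so the edges that survive a minimum deletion
  are triangle-free and Mantel's bound on n + 3 vertices applies to them.\<close>

lemma frustration_index_all_negative_ge:
  "(n\<^sup>2 + 4 * n - 8) div 4 \<le> frustration_index (complete_split n 3) (all_negative (complete_split n 3))"
proof -
  let ?G = "complete_split n 3"
  define S where "S = {card D | D. D \<subseteq> edges ?G \<and>
    balanced (delete_edges ?G D) (restrict (all_negative ?G) (edges ?G - D))}"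
  have "Min S \<in> S"
    unfolding S_def
    by (intro Min_in frustration_index_well_defined simple_graph_complete_split)
  then obtain D where D: "D \<subseteq> edges ?G" "Min S = card D"
    "balanced (delete_edges ?G D) (restrict (all_negative ?G) (edges ?G - D))"
    by (auto simp: S_def)
  have fin: "finite (edges ?G)"
    by (rule finite_edges[OF simple_graph_complete_split])
  have simple: "finite (verts ?G)" "\<And>e. e \<in> edges ?G \<Longrightarrow> e \<subseteq> verts ?G \<and> card e = 2"
    using simple_graph_complete_split[of n 3] by (auto simp: simple_graph_def)
  have "4 * card (edges ?G - D) \<le> (card (verts ?G))\<^sup>2"
  proof (rule mantel)
    fix u v w assume uvw: "{u, v} \<in> edges ?G - D" "{v, w} \<in> edges ?G - D" "{u, w} \<in> edges ?G - D"
    then have dist: "u \<noteq> v" "v \<noteq> w" "u \<noteq> w"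
      using simple(2)[of "{u, v}"] simple(2)[of "{v, w}"] simple(2)[of "{u, w}"] by auto
    have edge: "cycle_edge [u, v, w] i \<in> edges ?G - D" if "i < 3" for i
    proof -
      have "i = 0 \<or> i = 1 \<or> i = 2"
        using that by linarith
      then show ?thesis
        using uvw by (auto simp: cycle_edge_def insert_commute[of w u])
    qed
    then have "is_cycle (delete_edges ?G D) [u, v, w]"
      using dist uvw simple(2) by (auto simp: is_cycle_def delete_edges_def)
    moreover have "cycle_sign (restrict (all_negative ?G) (edges ?G - D)) [u, v, w] = (\<Prod>i<3::nat. -1)"
      unfolding cycle_sign_def
      by (rule prod.cong) (use edge in \<open>auto simp: all_negative_def\<close>)
    ultimately show False
      using D(3) by (auto simp: balanced_def eval_nat_numeral)
  qed (use simple in auto)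
  moreover have "card (verts ?G) = n + 3"
    by (simp add: complete_split_def join_def complete_graph_def edgeless_graph_def
        Plus_def[symmetric] card_Plus)
  moreover have "card (edges ?G) = card (edges ?G - D) + card D"
    using D(1) fin by (simp add: card_Diff_subset finite_subset card_mono)
  moreover have "2 * card (edges ?G) = n\<^sup>2 + 5 * n"
    using card_split_edges[of "{..<n}"] by (simp add: edges_complete_split)
  ultimately have "n\<^sup>2 + 4 * n \<le> 4 * card D + 9"
    by (simp add: power2_eq_square algebra_simps)
  \<comment> \<open>The dividend is at most \<open>4 * card D + 1\<close>, and the surplus 1
    disappears in the integer division.\<close>
  then have "(n\<^sup>2 + 4 * n - 8) div 4 \<le> card D"
    by linarith
  then show ?thesis
    using D(2) by (simp add: frustration_index_def S_def)
qed

theorem theorem33: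
  fixes n :: nat
  assumes "n \<ge> 5"
  shows "all_negative_uniquely_maximal (complete_split n 3) \<and>
    max_frustration (complete_split n 3) =
      frustration_index (complete_split n 3) (all_negative (complete_split n 3)) \<and>
    int (frustration_index (complete_split n 3) (all_negative (complete_split n 3))) =
      \<lfloor>(real n - 1)\<^sup>2 / 4 + 3 * real n / 2 - 9 / 4\<rfloor>"
proof -
  let ?G = "complete_split n 3"
  define N where "N = (n\<^sup>2 + 4 * n - 8) div 4"
  have "n * 5 \<le> n\<^sup>2"
    using assms by (simp add: power2_eq_square)
  \<comment> \<open>This makes the natural number subtractions of 8 and 12 exact.\<close>
  then have n_sq: "n\<^sup>2 + 4 * n \<ge> 45"
    using assms by linarith
  have le: "frustration_index ?G \<sigma> \<le> N" if "\<sigma> \<in> signatures ?G" for \<sigma>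
    using frustration_index_complete_split_le[OF assms that] n_sq by (auto simp: N_def split: if_splits)
  have all_neg: "frustration_index ?G (all_negative ?G) = N"
    using le[OF all_negative_in_signatures] frustration_index_all_negative_ge[of n] by (simp add: N_def)
  have max: "max_frustration ?G = N"
    unfolding max_frustration_def
    using max_frustration_well_defined(1)[OF simple_graph_complete_split, of n 3] le all_neg
    by (intro Max_eqI) (auto intro: image_eqI[OF _ all_negative_in_signatures])
  have "switching_equivalent ?G \<sigma> (all_negative ?G)"
    if \<sigma>: "\<sigma> \<in> signatures ?G" and eq: "frustration_index ?G \<sigma> = N" for \<sigma>
  proof (rule negative_triangles_switching_equivalent[OF _ \<sigma>])
    show "negative_triangles \<sigma> {..<n}"
    proof (rule ccontr)
      assume "\<not> negative_triangles \<sigma> {..<n}"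
      \<comment> \<open>Subtracting 12 instead of 8 lowers the quotient by exactly 1, so the maximum
        cannot be attained with a positive triangle.\<close>
      then have "N \<le> (n\<^sup>2 + 4 * n - 12) div 4"
        using frustration_index_complete_split_le[OF assms \<sigma>] eq by simp
      then show False
        using n_sq unfolding N_def by presburger
    qed
  qed (use assms in simp)
  then have "all_negative_uniquely_maximal ?G"
    by (simp add: all_negative_uniquely_maximal_def all_neg max)
  moreover have "int N = \<lfloor>(real n - 1)\<^sup>2 / 4 + 3 * real n / 2 - 9 / 4\<rfloor>"
  proof -
    have "(real n - 1)\<^sup>2 / 4 + 3 * real n / 2 - 9 / 4 = real (n\<^sup>2 + 4 * n - 8) / real 4"
      using n_sq by (simp add: power2_eq_square field_simps of_nat_diff)
    then show ?thesis
      by (simp only: floor_divide_of_nat_eq N_def)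
  qed
  ultimately show ?thesis
    using all_neg max by simp
qed

end
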